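(* Let $n\ge1$. The map $\Psi$ sending a semistandard non-spin column $\mathcal C=f(A,O,D)=g(B,O,C)$ for $\mathfrak{so}(2n+1)$ to the column $\Psi(\mathcal C)$ with entries $B$, $O$, $\overline C$ (from top to bottom) is a bijection from the set of semistandard non-spin columns onto the set of Lecouvey-admissible non-spin columns, and $split(\Psi(\mathcal C))=dble(\mathcal C)$ for every such $\mathcal C$. Consequently, extending $\Psi$ to tableaux column by column (with $\Psi(\mathfrak C)=\mathfrak C$ for a spin column $\mathfrak C$), an orthogonal tableau $T$ is semistandard if and only if $\Psi(T)$ is semistandard in the sense of Lecouvey.
   Context: Order the letters $1<2<\dots<n<0<\overline n<\dots<\overline 1$; write $[1,m]=\{1,\dots,m\}$ and $P\triangle Q=(P\cup Q)\setminus(P\cap Q)$. **Semistandard columns.** For $A,D\subset[1,n]$ and $k=\#O\ge0$, the column $f(A,O,D)$ consists, from top to bottom, of the elements of $A$ in increasing order, $k$ zeros, and the letters $\overline d$ ($d\in D$) in increasing order. Put $I=A\cap D=\{x_1<\dots<x_r\}$. The column is semistandard if (i) there is $J=\{y_1<\dots<y_r\}\subset[1,n]\setminus(A\triangle D)$ with $J\cap I=\emptyset$ and $y_i>x_i$ for all $i$; we take for $J$ the componentwise smallest such set; and (ii) $\#(A\cup D\cup J)+k\le n$. Put $B=(A\setminus I)\cup J$ and $C=(D\setminus I)\cup J$, and let $K$ be the set of the $k$ largest elements of $[1,n]\setminus(A\cup D\cup J)$. We also write $f(A,O,D)=g(B,O,C)$. The double $dble(f(A,O,D))$ is the two-column tableau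 with left column $A\cup K$, $\overline C$ and right column $B$, $\overline D\cup\overline K$ (each sorted increasingly). **Lecouvey-admissible columns.** For $B,C\subset[1,n]$ and $k=\#O\ge 0$, let $\mathcal C_L$ be the column with entries $B$ (increasing), $k$ zeros, and $\overline C$ (increasing). Let $J^1=(B\cap C)\cup\{n+1,\dots,n+k\}=\{y^1_1<\dots<y^1_m\}$. $\mathcal C_L$ is Lecouvey-admissible if there is a set $I^1=\{x^1_1<\dots<x^1_m\}\subset[1,n+k]\setminus(B\triangle C)$ with $I^1\cap J^1=\emptyset$ and $x^1_i<y^1_i$ for all $i$. Taking for $I^1$ the componentwise largest such set, put $A^1=(B\setminus J^1)\cup I^1$, $D^1=(C\setminus J^1)\cup I^1$; then $split(\mathcal C_L)$ is the two-column tableau with left column $A^1$, $\overline C$ and right column $B$, $\overline{D^1}$ (each sorted increasingly). **Spin columns and tableaux.** A spin column is a column of height $n$ with entries $A\cup\overline D$, $A\sqcup D=[1,n]$, sorted increasingly; its double is the pair formed by the column $1,2,\dots,n$ followed by the spin column. An orthogonal tableau $T$ is a sequence of columns, each either a semistandard non-spin column or a spin column, with weakly decreasing heights and at most one spin column, which must be the first. $T$ is semistandard if the juxtaposition $dble(T)$ of the doubles of its columns is semistandard (rows weakly increasing). A sequence $T_L$ of Lecouvey-admissible columns (of weakly decreasing heights), possibly preceded by one spin column, is semistandard in the sense of Lecouvey if the tableau obtained by replacing each admissible column by its split, and keeping the spin column (if any) as a single column, has weakly increasing rows. *)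

theory Defs
  imports Main
begin

datatype letter = Unbarred nat | Zero | Barred nat

text \<open>The order \<open>1 < 2 < \<dots> < n < 0 < \<close>bar \<open>n < \<dots> < \<close>bar \<open>1\<close>; it does not depend on \<open>n\<close>.\<close>

instantiation letter :: linorder
begin

fun less_eq_letter :: "letter \<Rightarrow> letter \<Rightarrow> bool" where
  "less_eq_letter (Unbarred i) (Unbarred j) \<longleftrightarrow> i \<le> j"
| "less_eq_letter (Unbarred i) Zero \<longleftrightarrow> True"
| "less_eq_letter (Unbarred i) (Barred j) \<longleftrightarrow> True"
| "less_eq_letter Zero (Unbarred j) \<longleftrightarrow> False"
| "less_eq_letter Zero Zero \<longleftrightarrow> True"
| "less_eq_letter Zero (Barred j) \<longleftrightarrow> True"
| "less_eq_letter (Barred i) (Unbarred j) \<longleftrightarrow> False"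
| "less_eq_letter (Barred i) Zero \<longleftrightarrow> False"
| "less_eq_letter (Barred i) (Barred j) \<longleftrightarrow> j \<le> i"

definition less_letter :: "letter \<Rightarrow> letter \<Rightarrow> bool" where
  "less_letter x y \<longleftrightarrow> x \<le> y \<and> \<not> y \<le> x"

instance
proof
  fix x y z :: letter
  show "x < y \<longleftrightarrow> x \<le> y \<and> \<not> y \<le> x" by (rule less_letter_def)
  show "x \<le> x" by (cases x) auto
  show "x \<le> y \<Longrightarrow> y \<le> z \<Longrightarrow> x \<le> z" by (cases x; cases y; cases z) auto
  show "x \<le> y \<Longrightarrow> y \<le> x \<Longrightarrow> x = y" by (cases x; cases y) auto
  show "x \<le> y \<or> y \<le> x" by (cases x; cases y) auto
qed

end

text \<open>\<open>col A k D\<close> is the column, listed from top to bottom, written \<open>f(A,O,D)\<close> in terms of its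
  own entries (\<open>k = #O\<close>).  The sets and the number of zeros can be read off the column again
  (\<open>col_read\<close> below).\<close>

definition col :: "nat set \<Rightarrow> nat \<Rightarrow> nat set \<Rightarrow> letter list" where
  "col A k D = sorted_list_of_set (Unbarred ` A) @ replicate k Zero @ sorted_list_of_set (Barred ` D)"

definition unbarred :: "letter list \<Rightarrow> nat set" where
  "unbarred c = {i. Unbarred i \<in> set c}"

definition zeros :: "letter list \<Rightarrow> nat" where
  "zeros c = count_list c Zero"

definition barred :: "letter list \<Rightarrow> nat set" where
  "barred c = {i. Barred i \<in> set c}"

lemma col_read:
  assumes "finite A" and "finite D"
  shows "unbarred (col A k D) = A" and "zeros (col A k D) = k" and "barred (col A k D) = D"
proof -
  have rep: "count_list (replicate k Zero) Zero = k" by (induction k) auto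
  have "count_list (sorted_list_of_set (Unbarred ` A)) Zero = 0"
    "count_list (sorted_list_of_set (Barred ` D)) Zero = 0"
    using assms by (auto simp: count_list_0_iff)
  with rep show "zeros (col A k D) = k" by (simp add: zeros_def col_def)
  show "unbarred (col A k D) = A" "barred (col A k D) = D"
    using assms by (auto simp: unbarred_def barred_def col_def)
qed

text \<open>A tableau is the list of its top-justified columns from left to right; row \<open>i\<close> (counted from
  \<open>0\<close>) is formed by the columns that reach it.\<close>

definition row :: "nat \<Rightarrow> letter list list \<Rightarrow> letter list" where
  "row i T = map (\<lambda>c. c ! i) (filter (\<lambda>c. i < length c) T)"

definition rows_weakly_increasing :: "letter list list \<Rightarrow> bool" where
  "rows_weakly_increasing T \<longleftrightarrow> (\<forall>i. sorted (row i T))"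

definition symdiff :: "nat set \<Rightarrow> nat set \<Rightarrow> nat set" where
  "symdiff P Q = (P \<union> Q) - (P \<inter> Q)"

text \<open>Both relations include that the two sets have the same cardinality.\<close>

definition comp_less :: "nat set \<Rightarrow> nat set \<Rightarrow> bool" where
  "comp_less X Y \<longleftrightarrow> list_all2 (<) (sorted_list_of_set X) (sorted_list_of_set Y)"

definition comp_le :: "nat set \<Rightarrow> nat set \<Rightarrow> bool" where
  "comp_le X Y \<longleftrightarrow> list_all2 (\<le>) (sorted_list_of_set X) (sorted_list_of_set Y)"

text \<open>Unspecified if no such element exists; used only for nonempty families of candidates.\<close>

definition comp_smallest :: "nat set set \<Rightarrow> nat set" where
  "comp_smallest S = (THE X. X \<in> S \<and> (\<forall>Y\<in>S. comp_le X Y))"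

definition comp_largest :: "nat set set \<Rightarrow> nat set" where
  "comp_largest S = (THE X. X \<in> S \<and> (\<forall>Y\<in>S. comp_le Y X))"

definition largest_elements :: "nat \<Rightarrow> nat set \<Rightarrow> nat set" where
  "largest_elements k X = set (take k (rev (sorted_list_of_set X)))"

definition J_candidates :: "nat \<Rightarrow> nat set \<Rightarrow> nat set \<Rightarrow> nat set set" where
  "J_candidates n A D =
     {J. J \<subseteq> {1..n} - symdiff A D \<and> J \<inter> (A \<inter> D) = {} \<and> comp_less (A \<inter> D) J}"

definition J_set :: "nat \<Rightarrow> nat set \<Rightarrow> nat set \<Rightarrow> nat set" where
  "J_set n A D = comp_smallest (J_candidates n A D)"

definition semistandard_data :: "nat \<Rightarrow> nat set \<Rightarrow> nat \<Rightarrow> nat set \<Rightarrow> bool" where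
  "semistandard_data n A k D \<longleftrightarrow>
     A \<subseteq> {1..n} \<and> D \<subseteq> {1..n} \<and> J_candidates n A D \<noteq> {} \<and>
     card (A \<union> D \<union> J_set n A D) + k \<le> n"

definition semistandard_columns :: "nat \<Rightarrow> letter list set" where
  "semistandard_columns n = {col A k D |A k D. semistandard_data n A k D}"

definition B_set :: "nat \<Rightarrow> nat set \<Rightarrow> nat set \<Rightarrow> nat set" where
  "B_set n A D = (A - (A \<inter> D)) \<union> J_set n A D"

definition C_set :: "nat \<Rightarrow> nat set \<Rightarrow> nat set \<Rightarrow> nat set" where
  "C_set n A D = (D - (A \<inter> D)) \<union> J_set n A D"

definition K_set :: "nat \<Rightarrow> nat set \<Rightarrow> nat \<Rightarrow> nat set \<Rightarrow> nat set" where
  "K_set n A k D = largest_elements k ({1..n} - (A \<union> D \<union> J_set n A D))"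

definition dble :: "nat \<Rightarrow> letter list \<Rightarrow> letter list \<times> letter list" where
  "dble n c = (let A = unbarred c; k = zeros c; D = barred c; K = K_set n A k D in
     (col (A \<union> K) 0 (C_set n A D), col (B_set n A D) 0 (D \<union> K)))"

definition J1_set :: "nat \<Rightarrow> nat set \<Rightarrow> nat \<Rightarrow> nat set \<Rightarrow> nat set" where
  "J1_set n B k C = (B \<inter> C) \<union> {n + 1..n + k}"

definition I1_candidates :: "nat \<Rightarrow> nat set \<Rightarrow> nat \<Rightarrow> nat set \<Rightarrow> nat set set" where
  "I1_candidates n B k C =
     {X. X \<subseteq> {1..n + k} - symdiff B C \<and> X \<inter> J1_set n B k C = {} \<and> comp_less X (J1_set n B k C)}"

definition I1_set :: "nat \<Rightarrow> nat set \<Rightarrow> nat \<Rightarrow> nat set \<Rightarrow> nat set" where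
  "I1_set n B k C = comp_largest (I1_candidates n B k C)"

definition admissible_data :: "nat \<Rightarrow> nat set \<Rightarrow> nat \<Rightarrow> nat set \<Rightarrow> bool" where
  "admissible_data n B k C \<longleftrightarrow> B \<subseteq> {1..n} \<and> C \<subseteq> {1..n} \<and> I1_candidates n B k C \<noteq> {}"

definition admissible_columns :: "nat \<Rightarrow> letter list set" where
  "admissible_columns n = {col B k C |B k C. admissible_data n B k C}"

definition lecouvey_split :: "nat \<Rightarrow> letter list \<Rightarrow> letter list \<times> letter list" where
  "lecouvey_split n c = (let B = unbarred c; k = zeros c; C = barred c;
       J1 = J1_set n B k C; I1 = I1_set n B k C; A1 = (B - J1) \<union> I1; D1 = (C - J1) \<union> I1 in
     (col A1 0 C, col B 0 D1))"

definition Psi :: "nat \<Rightarrow> letter list \<Rightarrow> letter list" where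
  "Psi n c = (let A = unbarred c; k = zeros c; D = barred c in
     col (B_set n A D) k (C_set n A D))"

definition spin_columns :: "nat \<Rightarrow> letter list set" where
  "spin_columns n = {col A 0 D |A D. A \<union> D = {1..n} \<and> A \<inter> D = {}}"

text \<open>A spin column can have the same entries as a non-spin column, so the columns of a tableau
  are tagged with their kind.\<close>

datatype column = Nonspin "letter list" | Spin "letter list"

fun entries :: "column \<Rightarrow> letter list" where
  "entries (Nonspin c) = c"
| "entries (Spin c) = c"

fun is_spin :: "column \<Rightarrow> bool" where
  "is_spin (Nonspin c) \<longleftrightarrow> False"
| "is_spin (Spin c) \<longleftrightarrow> True"

text \<open>The conditions on shapes shared by both kinds of tableaux, for a given set \<open>S\<close> of allowed
  non-spin columns.\<close>

definition tableau_over :: "nat \<Rightarrow> letter list set \<Rightarrow> column list \<Rightarrow> bool" where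
  "tableau_over n S T \<longleftrightarrow>
     set T \<subseteq> Nonspin ` S \<union> Spin ` spin_columns n \<and>
     sorted_wrt (\<ge>) (map (\<lambda>c. length (entries c)) T) \<and>
     (\<forall>i<length T. is_spin (T ! i) \<longrightarrow> i = 0)"

definition orthogonal_tableau :: "nat \<Rightarrow> column list \<Rightarrow> bool" where
  "orthogonal_tableau n T \<longleftrightarrow> tableau_over n (semistandard_columns n) T"

fun dble_column :: "nat \<Rightarrow> column \<Rightarrow> letter list list" where
  "dble_column n (Nonspin c) = [fst (dble n c), snd (dble n c)]"
| "dble_column n (Spin c) = [col {1..n} 0 {}, c]"

definition semistandard_tableau :: "nat \<Rightarrow> column list \<Rightarrow> bool" where
  "semistandard_tableau n T \<longleftrightarrow>
     orthogonal_tableau n T \<and> rows_weakly_increasing (concat (map (dble_column n) T))"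

fun split_column :: "nat \<Rightarrow> column \<Rightarrow> letter list list" where
  "split_column n (Nonspin c) = [fst (lecouvey_split n c), snd (lecouvey_split n c)]"
| "split_column n (Spin c) = [c]"

definition lecouvey_semistandard_tableau :: "nat \<Rightarrow> column list \<Rightarrow> bool" where
  "lecouvey_semistandard_tableau n T \<longleftrightarrow>
     tableau_over n (admissible_columns n) T \<and>
     rows_weakly_increasing (concat (map (split_column n) T))"

fun Psi_column :: "nat \<Rightarrow> column \<Rightarrow> column" where
  "Psi_column n (Nonspin c) = Nonspin (Psi n c)"
| "Psi_column n (Spin c) = Spin c"

definition Psi_tableau :: "nat \<Rightarrow> column list \<Rightarrow> column list" where
  "Psi_tableau n T = map (Psi_column n) T"

end

theory Submission
  imports Defs
begin

text \<open>Disjoint sets compare componentwise exactly when their elements, read as opening and closing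
  brackets, form a ballot word. Hence both "\<open>J\<close> is the smallest set above \<open>I\<close>" and "\<open>I\<close> is the
  largest set below \<open>J\<close>" amount to one symmetric condition: the word is balanced and no unused
  position of the ambient set is enclosed by a pair of brackets. So \<open>I\<close> and \<open>J\<close> determine each
  other. Adding closing brackets at \<open>n + 1, \<dots>, n + k\<close> and opening ones at the \<open>k\<close> largest unused
  positions preserves the condition, which identifies Lecouvey's \<open>I\<^sup>1\<close> with \<open>I \<union> K\<close>.\<close>

section \<open>Componentwise comparison by counting\<close>

definition count_below :: "nat set \<Rightarrow> nat \<Rightarrow> nat" where
  "count_below X t = card {x \<in> X. x < t}"

text \<open>Prefix counts also make sense for overlapping sets, where they give the weak
  componentwise order; so one predicate serves both \<open>comp_le\<close> and
  \<open>comp_less\<close>.\<close>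

definition ballot :: "nat set \<Rightarrow> nat set \<Rightarrow> bool" where
  "ballot X Y \<longleftrightarrow> card X = card Y \<and> (\<forall>t. count_below Y t \<le> count_below X t)"

lemma count_below_0 [simp]: "count_below X 0 = 0"
  by (simp add: count_below_def)

lemma count_below_Suc:
  assumes "finite X"
  shows "count_below X (Suc t) = count_below X t + (if t \<in> X then 1 else 0)"
proof -
  have "{x \<in> X. x < Suc t} = (if t \<in> X then insert t {x \<in> X. x < t} else {x \<in> X. x < t})"
    by (auto simp: less_Suc_eq)
  then show ?thesis
    using assms by (simp add: count_below_def)
qed

lemma count_below_Un:
  assumes "finite X" "finite Y" "X \<inter> Y = {}"
  shows "count_below (X \<union> Y) t = count_below X t + count_below Y t"
proof -
  have "{x \<in> X \<union> Y. x < t} = {x \<in> X. x < t} \<union> {x \<in> Y. x < t}" by auto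
  then show ?thesis
    using assms by (simp add: count_below_def card_Un_disjoint disjoint_iff)
qed

lemma count_below_le_card: "finite X \<Longrightarrow> count_below X t \<le> card X"
  by (auto simp: count_below_def intro: card_mono)

lemma count_below_eq_card:
  assumes "\<And>x. x \<in> X \<Longrightarrow> x < t"
  shows "count_below X t = card X"
proof -
  have "{x \<in> X. x < t} = X" using assms by auto
  then show ?thesis by (simp add: count_below_def)
qed

lemma count_below_eq_0:
  assumes "\<And>x. x \<in> X \<Longrightarrow> t \<le> x"
  shows "count_below X t = 0"
proof -
  have "{x \<in> X. x < t} = {}" using assms by fastforce
  then show ?thesis unfolding count_below_def by simp
qed

lemma count_below_mono: "finite X \<Longrightarrow> s \<le> t \<Longrightarrow> count_below X s \<le> count_below X t"
  by (auto simp: count_below_def intro: card_mono)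

lemma count_below_subset: "finite Y \<Longrightarrow> X \<subseteq> Y \<Longrightarrow> count_below X t \<le> count_below Y t"
  by (auto simp: count_below_def intro: card_mono)

lemma count_below_gap:
  assumes "s \<le> t" "\<And>x. x \<in> X \<Longrightarrow> s \<le> x \<Longrightarrow> t \<le> x"
  shows "count_below X s = count_below X t"
proof -
  have "{x \<in> X. x < s} = {x \<in> X. x < t}" using assms by fastforce
  then show ?thesis by (simp add: count_below_def)
qed

text \<open>Exchanging one element is the perturbation used in the existence proofs below. Both
  corrections are added, one on each side, to avoid truncated subtraction.\<close>

lemma count_below_insert_remove:
  assumes "finite X" "y \<in> X" "z \<notin> X"
  shows "count_below (insert z (X - {y})) t + (if y < t then 1 else 0)
    = count_below X t + (if z < t then 1 else 0)"
proof -
  have single: "count_below {u} t = (if u < t then 1 else 0)" for u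
  proof -
    have "{x \<in> {u}. x < t} = (if u < t then {u} else {})" by auto
    then show ?thesis by (simp add: count_below_def)
  qed
  have "count_below ({z} \<union> (X - {y})) t = count_below {z} t + count_below (X - {y}) t"
    using assms by (intro count_below_Un) auto
  moreover have "count_below ({y} \<union> (X - {y})) t = count_below {y} t + count_below (X - {y}) t"
    using assms by (intro count_below_Un) auto
  ultimately show ?thesis
    using assms single by (simp add: insert_absorb)
qed

text \<open>Membership of \<open>t\<close> is the jump of the counting function from
  \<open>t\<close> to \<open>Suc t\<close>.\<close>

lemma count_below_inject:
  assumes "finite X" "finite Y" "\<And>t. count_below X t = count_below Y t"
  shows "X = Y"
proof -
  have "t \<in> X \<longleftrightarrow> t \<in> Y" for t
    using assms(3)[of t] assms(3)[of "Suc t"] assms(1,2) by (simp add: count_below_Suc split: if_splits)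
  then show ?thesis by blast
qed

section \<open>Componentwise order as dominance of counting functions\<close>

lemma list_all2_le_iff_filter:
  fixes xs ys :: "nat list"
  assumes "sorted xs" "sorted ys" "length xs = length ys"
  shows "list_all2 (\<le>) xs ys \<longleftrightarrow> (\<forall>t. length (filter (\<lambda>y. y < t) ys) \<le> length (filter (\<lambda>x. x < t) xs))"
proof
  assume "list_all2 (\<le>) xs ys"
  then show "\<forall>t. length (filter (\<lambda>y. y < t) ys) \<le> length (filter (\<lambda>x. x < t) xs)"
    by (induction rule: list_all2_induct) (auto intro: le_SucI)
next
  assume "\<forall>t. length (filter (\<lambda>y. y < t) ys) \<le> length (filter (\<lambda>x. x < t) xs)"
  with assms show "list_all2 (\<le>) xs ys"
  proof (induction xs arbitrary: ys)
    case Nil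
    then show ?case by simp
  next
    case (Cons x xs)
    obtain y ys' where ys: "ys = y # ys'"
      using Cons.prems(3) by (cases ys) auto
    \<comment> \<open>The threshold \<open>Suc y\<close> counts the head \<open>y\<close>, so some
      entry of \<open>x # xs\<close> is at most \<open>y\<close>; by sortedness its head
      \<open>x\<close> is.\<close>
    have "filter (\<lambda>u. u < Suc y) (x # xs) \<noteq> []"
      using Cons.prems(4)[rule_format, of "Suc y"] ys by auto
    then have xy: "x \<le> y"
      using Cons.prems(1) by (auto simp: filter_empty_conv split: if_splits)
    \<comment> \<open>For \<open>y < t\<close> both heads are counted and cancel; otherwise
      sortedness leaves nothing of \<open>ys'\<close> below \<open>t\<close>.\<close>
    have "length (filter (\<lambda>y. y < t) ys') \<le> length (filter (\<lambda>x. x < t) xs)" for t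
    proof (cases "y < t")
      case True
      then show ?thesis using Cons.prems(4)[rule_format, of t] ys xy by simp
    next
      case False
      then have "filter (\<lambda>y. y < t) ys' = []"
        using Cons.prems(2) ys by (auto simp: filter_empty_conv)
      then show ?thesis by simp
    qed
    then show ?case
      using Cons.IH[of ys'] Cons.prems ys xy by auto
  qed
qed

lemma length_filter_sorted_list_of_set:
  "finite X \<Longrightarrow> length (filter (\<lambda>x. x < t) (sorted_list_of_set X)) = count_below X t"
  by (simp add: count_below_def distinct_length_filter Int_def conj_commute)

lemma comp_le_iff_ballot:
  assumes "finite X" "finite Y"
  shows "comp_le X Y \<longleftrightarrow> ballot X Y"
proof (cases "card X = card Y")
  case True
  then show ?thesis
    using assms
    by (simp add: comp_le_def ballot_def list_all2_le_iff_filter length_filter_sorted_list_of_set)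
next
  case False
  then show ?thesis
    using assms by (auto simp: comp_le_def ballot_def dest: list_all2_lengthD)
qed

text \<open>Disjoint sets never share an entry, so strict and weak comparison coincide.\<close>

lemma comp_less_iff_ballot:
  assumes "finite X" "finite Y" "X \<inter> Y = {}"
  shows "comp_less X Y \<longleftrightarrow> ballot X Y"
proof -
  have "list_all2 (<) xs ys \<longleftrightarrow> list_all2 (\<le>) xs ys" if "set xs \<inter> set ys = {}" for xs ys :: "nat list"
    using that by (auto elim!: list.rel_mono_strong simp: order_less_le)
  then have "comp_less X Y \<longleftrightarrow> comp_le X Y"
    using assms by (simp add: comp_less_def comp_le_def)
  then show ?thesis using comp_le_iff_ballot assms by simp
qed

lemma ballot_antisym:
  "finite X \<Longrightarrow> finite Y \<Longrightarrow> ballot X Y \<Longrightarrow> ballot Y X \<Longrightarrow> X = Y"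
  by (rule count_below_inject) (auto simp: ballot_def intro: antisym)

section \<open>Bracketings\<close>

text \<open>The difference of the two counts is the bracket depth; the last conjunct puts every free
  position of \<open>F\<close> at depth zero.\<close>

definition bracketing :: "nat set \<Rightarrow> nat set \<Rightarrow> nat set \<Rightarrow> bool" where
  "bracketing F I J \<longleftrightarrow> I \<subseteq> F \<and> J \<subseteq> F \<and> I \<inter> J = {} \<and> ballot I J \<and>
     (\<forall>z\<in>F - (I \<union> J). count_below I z = count_below J z)"

section \<open>Bracketings are extremal on both sides\<close>

text \<open>Induction along prefixes: \<open>Y\<close> can only gain on \<open>J\<close> at some
  \<open>t\<close> in \<open>Y - J\<close>. Such a \<open>t\<close> is free, so \<open>J\<close> has
  there as many elements below as \<open>I\<close>, and \<open>I\<close> bounds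
  \<open>Y\<close>.\<close>

lemma bracketing_smallest:
  assumes "finite F" "bracketing F I J" "Y \<subseteq> F - I" "ballot I Y"
  shows "ballot J Y"
proof -
  have fin: "finite I" "finite J" "finite Y"
    using assms by (auto simp: bracketing_def intro: finite_subset)
  have "count_below Y t \<le> count_below J t" for t
  proof (induction t)
    case (Suc t)
    show ?case
    proof (cases "t \<in> Y \<and> t \<notin> J")
      case True
      then have z: "t \<in> F - (I \<union> J)" "t \<notin> I" using assms(3) by auto
      have "count_below Y (Suc t) \<le> count_below I (Suc t)" using assms(4) by (simp add: ballot_def)
      then show ?thesis
        using z assms(2) fin by (simp add: bracketing_def count_below_Suc)
    next
      case False
      then show ?thesis using Suc fin by (simp add: count_below_Suc)
    qed
  qed simp
  then show ?thesis using assms by (simp add: ballot_def bracketing_def)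
qed

text \<open>The mirror image runs downwards from a bound \<open>N\<close> of \<open>F\<close>, where
  all counts are full. The step can only fail at some \<open>t\<close> in \<open>X - I\<close>; such
  a \<open>t\<close> is free, so \<open>I\<close> counts there like \<open>J\<close>, which
  \<open>X\<close> dominates.\<close>

lemma bracketing_largest:
  assumes "finite F" "bracketing F I J" "X \<subseteq> F - J" "ballot X J"
  shows "ballot X I"
proof -
  have fin: "finite I" "finite J" "finite X"
    using assms by (auto simp: bracketing_def intro: finite_subset)
  have card: "card X = card I" using assms by (simp add: ballot_def bracketing_def)
  have "count_below I t \<le> count_below X t" for t
  proof -
    obtain N where N: "t \<le> N" "\<And>x. x \<in> F \<Longrightarrow> x < N"
      using assms(1)
      by (metis finite_nat_set_iff_bounded le_cases order_less_le_trans)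
    from N(1) show ?thesis
    proof (induction rule: inc_induct)
      case base
      have "count_below X N = card X" "count_below I N = card I"
        using N assms by (auto intro!: count_below_eq_card simp: bracketing_def)
      with card show ?case by simp
    next
      case (step t)
      show ?case
      proof (cases "t \<in> X \<and> t \<notin> I")
        case True
        then have "t \<in> F - (I \<union> J)" using assms(3) by auto
        then show ?thesis
          using assms(2,4) by (simp add: bracketing_def ballot_def)
      next
        case False
        then show ?thesis using step fin by (simp add: count_below_Suc split: if_splits)
      qed
    qed
  qed
  with card show ?thesis by (simp add: ballot_def)
qed

section \<open>Existence of bracketings by an extremal choice\<close>

text \<open>The sum of the elements turns the componentwise order into a single number to minimise,
  so no greedy construction is required.\<close>

lemma bracketing_exists_right:
  assumes "finite F" "I \<subseteq> F" "Y \<subseteq> F - I" "ballot I Y"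
  shows "\<exists>J. bracketing F I J"
proof -
  obtain J where J: "J \<subseteq> F - I" "ballot I J"
    and min: "\<And>J'. J' \<subseteq> F - I \<Longrightarrow> ballot I J' \<Longrightarrow> \<Sum>J \<le> \<Sum>J'"
    using ex_has_least_nat[of "\<lambda>J. J \<subseteq> F - I \<and> ballot I J" Y "\<lambda>J. \<Sum>J"] assms by auto
  have fin: "finite I" "finite J"
    using assms J by (auto intro: finite_subset)
  \<comment> \<open>Otherwise the next element of \<open>J\<close> could be moved down to \<open>z\<close>, lowering the sum.\<close>
  have "count_below I z = count_below J z" if z: "z \<in> F - (I \<union> J)" for z
  proof (rule ccontr)
    assume "count_below I z \<noteq> count_below J z"
    then have lt: "count_below J z < count_below I z"
      using J(2) by (metis ballot_def le_neq_implies_less)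
    have "\<exists>y. y \<in> J \<and> z < y"
    proof (rule ccontr)
      assume "\<not> ?thesis"
      then have "count_below J z = card J"
        using z by (intro count_below_eq_card) (metis DiffD2 UnI2 linorder_neqE_nat)
      then show False
        using lt count_below_le_card[OF fin(1), of z] J(2) by (simp add: ballot_def)
    qed
    define y where "y = (LEAST y. y \<in> J \<and> z < y)"
    have y: "y \<in> J" "z < y"
      using \<open>\<exists>y. y \<in> J \<and> z < y\<close> LeastI_ex[of "\<lambda>y. y \<in> J \<and> z < y"] by (auto simp: y_def)
    have least: "y \<le> u" if "u \<in> J" "z < u" for u
      using that by (auto simp: y_def intro: Least_le)
    define J' where "J' = insert z (J - {y})"
    have cnt: "count_below J' t + (if y < t then 1 else 0) = count_below J t + (if z < t then 1 else 0)" for t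
      using count_below_insert_remove[OF fin(2) y(1), of z t] z by (simp add: J'_def)
    have "count_below J' t \<le> count_below I t" for t
    \<comment> \<open>Only prefixes ending between \<open>z\<close> and \<open>y\<close> gain an
      element. There the count of \<open>J\<close> is still its value at \<open>z\<close>, strictly
      below that of \<open>I\<close>, which leaves room for one more.\<close>
    proof (cases "z < t \<and> t \<le> y")
      case True
      have "count_below J z = count_below J t"
        using True least z by (intro count_below_gap) (metis DiffD2 UnI2 le_trans order_le_less)+
      then show ?thesis
        using cnt[of t] lt True count_below_mono[OF fin(1), of z t] by (simp split: if_splits)
    next
      case False
      then show ?thesis
        using cnt[of t] J(2) y(2) by (auto simp: ballot_def split: if_splits)
    qed
    moreover have "card J' = card J"
      using card_Suc_Diff1[OF fin(2) y(1)] z fin by (simp add: J'_def)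
    ultimately have "ballot I J'" using J(2) by (simp add: ballot_def)
    moreover have "J' \<subseteq> F - I" using J(1) z by (auto simp: J'_def)
    ultimately have "\<Sum>J \<le> \<Sum>J'" by (rule min[rotated])
    moreover have "\<Sum>J' = z + \<Sum>(J - {y})" using fin z by (simp add: J'_def)
    moreover have "\<Sum>J = y + \<Sum>(J - {y})" using sum.remove[OF fin(2) y(1), of id] by simp
    ultimately show False using y(2) by simp
  qed
  then have "bracketing F I J" using J assms by (auto simp: bracketing_def)
  then show ?thesis ..
qed

lemma bracketing_exists_left:
  assumes "finite F" "J \<subseteq> F" "X \<subseteq> F - J" "ballot X J"
  shows "\<exists>I. bracketing F I J"
proof -
  \<comment> \<open>Maximising a sum, unlike minimising it, calls for an upper bound on all
    candidates.\<close>
  have bound: "\<Sum>I < Suc (\<Sum>F)" if "I \<subseteq> F - J" for I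
    using that assms(1) by (auto simp: less_Suc_eq_le intro!: sum_mono2)
  obtain I where I: "I \<subseteq> F - J" "ballot I J"
    and max: "\<And>I'. I' \<subseteq> F - J \<Longrightarrow> ballot I' J \<Longrightarrow> \<Sum>I' \<le> \<Sum>I"
    using ex_has_greatest_nat[of "\<lambda>I. I \<subseteq> F - J \<and> ballot I J" X "\<lambda>I. \<Sum>I" "Suc (\<Sum>F)"] assms bound
    by (metis (no_types, lifting) less_imp_le_nat)
  have fin: "finite I" "finite J"
    using assms I by (auto intro: finite_subset)
  \<comment> \<open>Otherwise the preceding element of \<open>I\<close> could be moved up to \<open>z\<close>, raising the sum.\<close>
  have "count_below I z = count_below J z" if z: "z \<in> F - (I \<union> J)" for z
  proof (rule ccontr)
    assume "count_below I z \<noteq> count_below J z"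
    then have lt: "count_below J z < count_below I z"
      using I(2) by (metis ballot_def le_neq_implies_less)
    define L where "L = {x \<in> I. x < z}"
    have L: "finite L" "L \<noteq> {}"
      using lt fin(1) unfolding L_def count_below_def by (simp, metis card.empty not_less0)
    define x where "x = Max L"
    have x: "x \<in> I" "x < z"
      using Max_in[OF L] by (auto simp: x_def L_def)
    have greatest: "u \<le> x" if "u \<in> I" "u < z" for u
      using that L by (auto simp: x_def L_def)
    define I' where "I' = insert z (I - {x})"
    have cnt: "count_below I' t + (if x < t then 1 else 0) = count_below I t + (if z < t then 1 else 0)" for t
      using count_below_insert_remove[OF fin(1) x(1), of z t] z by (simp add: I'_def)
    have "count_below J t \<le> count_below I' t" for t
    \<comment> \<open>Only these prefixes lose an element. \<open>I\<close> is constant from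
      \<open>t\<close> up to \<open>z\<close>, where it strictly exceeds \<open>J\<close>, and
      \<open>J\<close> has no more elements below \<open>t\<close> than below
      \<open>z\<close>.\<close>
    proof (cases "x < t \<and> t \<le> z")
      case True
      have "count_below I t = count_below I z"
        using True greatest by (intro count_below_gap) (meson leD leI le_less_trans less_le_trans order_le_less)+
      then show ?thesis
        using cnt[of t] lt True count_below_mono[OF fin(2), of t z] by (simp split: if_splits)
    next
      case False
      moreover have "count_below J t \<le> count_below I t" using I(2) by (simp add: ballot_def)
      ultimately show ?thesis
        using cnt[of t] x(2) by (auto split: if_splits)
    qed
    moreover have "card I' = card I"
      using card_Suc_Diff1[OF fin(1) x(1)] z fin by (simp add: I'_def)
    ultimately have "ballot I' J" using I(2) by (simp add: ballot_def)
    moreover have "I' \<subseteq> F - J" using I(1) z by (auto simp: I'_def)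
    ultimately have "\<Sum>I' \<le> \<Sum>I" by (rule max[rotated])
    moreover have "\<Sum>I' = z + \<Sum>(I - {x})" using fin z by (simp add: I'_def)
    moreover have "\<Sum>I = x + \<Sum>(I - {x})" using sum.remove[OF fin(1) x(1), of id] by simp
    ultimately show False using x(2) by simp
  qed
  then have "bracketing F I J" using I assms by (auto simp: bracketing_def)
  then show ?thesis ..
qed

text \<open>Both left sides are largest below \<open>J\<close>, hence dominate each other. This will
  make \<open>Psi\<close> injective.\<close>

lemma bracketing_left_unique:
  assumes "finite F" "bracketing F I J" "bracketing F I' J"
  shows "I = I'"
proof (rule ballot_antisym)
  show "finite I" "finite I'" using assms by (auto simp: bracketing_def intro: finite_subset)
  show "ballot I I'" "ballot I' I"
    using assms by (auto intro!: bracketing_largest[of F _ J] simp: bracketing_def)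
qed

text \<open>As \<open>comp_smallest\<close> is a definite description, extremality must be joined by
  uniqueness, which is antisymmetry of \<open>ballot\<close>.\<close>

lemma comp_smallest_eq_bracketing:
  assumes "finite F" "bracketing F I J"
  shows "comp_smallest {Y. Y \<subseteq> F - I \<and> ballot I Y} = J"
proof -
  have fin: "finite Y" if "Y \<subseteq> F" for Y using that assms(1) by (rule finite_subset)
  have J: "J \<subseteq> F" "J \<subseteq> F - I" "ballot I J" using assms by (auto simp: bracketing_def)
  have extreme: "comp_le J Y" if "Y \<subseteq> F - I" "ballot I Y" for Y
    using bracketing_smallest[OF assms that] comp_le_iff_ballot fin[of Y] fin[of J] J(1) that(1) by auto
  show ?thesis
    unfolding comp_smallest_def
  proof (rule the_equality)
    show "J \<in> {Y. Y \<subseteq> F - I \<and> ballot I Y} \<and> (\<forall>Y\<in>{Y. Y \<subseteq> F - I \<and> ballot I Y}. comp_le J Y)"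
      using J extreme by blast
  next
    fix Y assume Y: "Y \<in> {Y. Y \<subseteq> F - I \<and> ballot I Y} \<and> (\<forall>Z\<in>{Y. Y \<subseteq> F - I \<and> ballot I Y}. comp_le Y Z)"
    then have "comp_le Y J" "comp_le J Y" "finite Y"
      using J extreme fin[of Y] by auto
    then show "Y = J"
      using comp_le_iff_ballot[of Y J] comp_le_iff_ballot[of J Y] ballot_antisym[of Y J] fin[OF J(1)] by simp
  qed
qed

lemma comp_largest_eq_bracketing:
  assumes "finite F" "bracketing F I J"
  shows "comp_largest {X. X \<subseteq> F - J \<and> ballot X J} = I"
proof -
  have fin: "finite Y" if "Y \<subseteq> F" for Y using that assms(1) by (rule finite_subset)
  have I: "I \<subseteq> F" "I \<subseteq> F - J" "ballot I J" using assms by (auto simp: bracketing_def)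
  have extreme: "comp_le Y I" if "Y \<subseteq> F - J" "ballot Y J" for Y
    using bracketing_largest[OF assms that] comp_le_iff_ballot fin[of Y] fin[of I] I(1) that(1) by auto
  show ?thesis
    unfolding comp_largest_def
  proof (rule the_equality)
    show "I \<in> {Y. Y \<subseteq> F - J \<and> ballot Y J} \<and> (\<forall>Y\<in>{Y. Y \<subseteq> F - J \<and> ballot Y J}. comp_le Y I)"
      using I extreme by blast
  next
    fix Y assume Y: "Y \<in> {Y. Y \<subseteq> F - J \<and> ballot Y J} \<and> (\<forall>Z\<in>{Y. Y \<subseteq> F - J \<and> ballot Y J}. comp_le Z Y)"
    then have "comp_le Y I" "comp_le I Y" "finite Y"
      using I extreme fin[of Y] by auto
    then show "Y = I"
      using comp_le_iff_ballot[of Y I] comp_le_iff_ballot[of I Y] ballot_antisym[of Y I] fin[OF I(1)] by simp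
  qed
qed

section \<open>Adding brackets for the zeros\<close>

lemma largest_elements_properties:
  assumes "finite X" "k \<le> card X"
  shows "largest_elements k X \<subseteq> X" "card (largest_elements k X) = k"
    "\<And>x y. x \<in> largest_elements k X \<Longrightarrow> y \<in> X - largest_elements k X \<Longrightarrow> y < x"
proof -
  define xs where "xs = rev (sorted_list_of_set X)"
  have xs: "set xs = X" "distinct xs" "length xs = card X" "sorted_wrt (>) xs"
    using assms by (auto simp: xs_def sorted_wrt_rev)
  have L: "largest_elements k X = set (take k xs)" by (simp add: largest_elements_def xs_def)
  show "largest_elements k X \<subseteq> X" using L xs(1) set_take_subset by metis
  show "card (largest_elements k X) = k"
    using L xs assms(2) by (simp add: distinct_card)
  fix x y assume "x \<in> largest_elements k X" "y \<in> X - largest_elements k X"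
  moreover have "X = set (take k xs) \<union> set (drop k xs)"
    using xs(1) by (metis append_take_drop_id set_append)
  moreover have "sorted_wrt (>) (take k xs @ drop k xs)" using xs(4) by simp
  ultimately show "y < x" using L unfolding sorted_wrt_append by blast
qed

text \<open>Prefixes within \<open>{1..n}\<close> meet only additional opening brackets; longer ones
  have met all \<open>k\<close> of them and at most \<open>k\<close> additional closing ones, so the
  depth never becomes negative.\<close>

lemma bracketing_extend:
  assumes F: "F \<subseteq> {1..n}" and br: "bracketing F I J"
    and K: "K \<subseteq> F - (I \<union> J)" "card K = k"
    and top: "\<And>x y. x \<in> K \<Longrightarrow> y \<in> F - (I \<union> J) - K \<Longrightarrow> y < x"
  shows "bracketing (F \<union> {n+1..n+k}) (I \<union> K) (J \<union> {n+1..n+k})"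
proof -
  have sub: "I \<subseteq> F" "J \<subseteq> F" "I \<inter> J = {}" "ballot I J"
    and free: "\<And>z. z \<in> F - (I \<union> J) \<Longrightarrow> count_below I z = count_below J z"
    using br by (auto simp: bracketing_def)
  have "finite F" using F finite_subset by blast
  then have fin: "finite I" "finite J" "finite K"
    using sub K by (auto intro: finite_subset)
  have high: "x \<le> n" if "x \<in> F" for x using F that by auto
  have cI: "count_below (I \<union> K) t = count_below I t + count_below K t" for t
    using fin K by (intro count_below_Un) auto
  have cJ: "count_below (J \<union> {n+1..n+k}) t = count_below J t + count_below {n+1..n+k} t" for t
    using fin sub high by (intro count_below_Un) fastforce+
  have "card (I \<union> K) = card I + k"
    using fin K by (subst card_Un_disjoint) auto
  moreover have "card (J \<union> {n+1..n+k}) = card J + k"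
    using fin sub high by (subst card_Un_disjoint) fastforce+
  moreover have "count_below (J \<union> {n+1..n+k}) t \<le> count_below (I \<union> K) t" for t
  proof (cases "t \<le> n")
    case True
    then have "count_below {n+1..n+k} t = 0" by (intro count_below_eq_0) auto
    then show ?thesis using sub(4) cI cJ by (simp add: ballot_def trans_le_add1)
  next
    case False
    then have "count_below K t = k"
      using K high by (subst count_below_eq_card) fastforce+
    moreover have "count_below {n+1..n+k} t \<le> k"
      using count_below_le_card[of "{n+1..n+k}" t] by simp
    ultimately show ?thesis using sub(4) cI cJ by (simp add: ballot_def add_mono)
  qed
  ultimately have "ballot (I \<union> K) (J \<union> {n+1..n+k})"
    using sub(4) by (simp add: ballot_def)
  moreover have "count_below (I \<union> K) z = count_below (J \<union> {n+1..n+k}) z"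
    if "z \<in> F \<union> {n+1..n+k} - ((I \<union> K) \<union> (J \<union> {n+1..n+k}))" for z
  proof -
    \<comment> \<open>Every position beyond \<open>n\<close> carries a closing bracket, so
      \<open>z\<close> lies in \<open>F\<close>. By maximality of \<open>K\<close> it precedes all
      additional brackets, and its depth is the old one.\<close>
    have z: "z \<in> F - (I \<union> J) - K" using that by auto
    have "count_below K z = 0" using top z by (intro count_below_eq_0) (auto intro: less_imp_le)
    moreover have "count_below {n+1..n+k} z = 0"
      using high z by (intro count_below_eq_0) fastforce
    ultimately show ?thesis using cI cJ free z by simp
  qed
  moreover have "(I \<union> K) \<inter> (J \<union> {n+1..n+k}) = {}"
    using sub K high by fastforce
  moreover have "I \<union> K \<subseteq> F \<union> {n+1..n+k}" "J \<union> {n+1..n+k} \<subseteq> F \<union> {n+1..n+k}"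
    using sub K by auto
  ultimately show ?thesis unfolding bracketing_def by blast
qed

section \<open>Columns\<close>

lemma subset_Diff_iff: "X \<subseteq> P - Q \<longleftrightarrow> X \<subseteq> P \<and> X \<inter> Q = {}"
  by blast

text \<open>Disjointness is built into the candidates, so \<open>comp_less\<close> becomes
  \<open>ballot\<close>, and the family takes the shape \<open>F - I\<close> of the extremality
  results.\<close>

lemma J_candidates_eq:
  assumes "A \<subseteq> {1..n}"
  shows "J_candidates n A D =
    {J. J \<subseteq> ({1..n} - symdiff A D) - A \<inter> D \<and> ballot (A \<inter> D) J}"
proof -
  have "finite (A \<inter> D)" using assms by (meson finite_Int finite_atLeastAtMost finite_subset)
  moreover have "finite J" if "J \<subseteq> {1..n} - symdiff A D" for J
    using that by (meson finite_Diff finite_atLeastAtMost finite_subset)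
  ultimately have eq: "comp_less (A \<inter> D) J \<longleftrightarrow> ballot (A \<inter> D) J"
    if "J \<subseteq> {1..n} - symdiff A D" "J \<inter> (A \<inter> D) = {}" for J
    using that comp_less_iff_ballot[of "A \<inter> D" J] by (metis Int_commute)
  show ?thesis
    unfolding J_candidates_def
  proof (rule Collect_cong)
    fix J show "(J \<subseteq> {1..n} - symdiff A D \<and> J \<inter> (A \<inter> D) = {} \<and> comp_less (A \<inter> D) J) \<longleftrightarrow>
      (J \<subseteq> {1..n} - symdiff A D - A \<inter> D \<and> ballot (A \<inter> D) J)"
      using eq[of J] subset_Diff_iff[of J "{1..n} - symdiff A D" "A \<inter> D"] by argo
  qed
qed

lemma I1_candidates_eq:
  assumes "B \<subseteq> {1..n}"
  shows "I1_candidates n B k C =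
    {X. X \<subseteq> ({1..n+k} - symdiff B C) - J1_set n B k C \<and> ballot X (J1_set n B k C)}"
proof -
  have "finite (J1_set n B k C)"
    using assms unfolding J1_set_def by (meson finite_Int finite_UnI finite_atLeastAtMost finite_subset)
  moreover have "finite X" if "X \<subseteq> {1..n+k} - symdiff B C" for X
    using that by (meson finite_Diff finite_atLeastAtMost finite_subset)
  ultimately have eq: "comp_less X (J1_set n B k C) \<longleftrightarrow> ballot X (J1_set n B k C)"
    if "X \<subseteq> {1..n+k} - symdiff B C" "X \<inter> J1_set n B k C = {}" for X
    using that comp_less_iff_ballot[of X "J1_set n B k C"] by metis
  show ?thesis
    unfolding I1_candidates_def
  proof (rule Collect_cong)
    fix X show "(X \<subseteq> {1..n+k} - symdiff B C \<and> X \<inter> J1_set n B k C = {} \<and> comp_less X (J1_set n B k C)) \<longleftrightarrow>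
      (X \<subseteq> {1..n+k} - symdiff B C - J1_set n B k C \<and> ballot X (J1_set n B k C))"
      using eq[of X] subset_Diff_iff[of X "{1..n+k} - symdiff B C" "J1_set n B k C"] by argo
  qed
qed

text \<open>Any candidate at all yields some bracketing, and the right side of that is the smallest
  candidate.\<close>

lemma semistandard_data_bracketing:
  assumes "semistandard_data n A k D"
  shows "bracketing ({1..n} - symdiff A D) (A \<inter> D) (J_set n A D)"
proof -
  let ?F = "{1..n} - symdiff A D"
  have A: "A \<subseteq> {1..n}" "J_candidates n A D \<noteq> {}" using assms by (auto simp: semistandard_data_def)
  then obtain Y where "Y \<subseteq> ?F - A \<inter> D" "ballot (A \<inter> D) Y"
    unfolding J_candidates_eq[OF A(1)] by blast
  moreover have sub: "A \<inter> D \<subseteq> ?F" using A(1) by (auto simp: symdiff_def)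
  ultimately obtain J where J: "bracketing ?F (A \<inter> D) J"
    using bracketing_exists_right[of ?F "A \<inter> D" Y] by auto
  have "J_set n A D = J"
    unfolding J_set_def J_candidates_eq[OF A(1)] by (rule comp_smallest_eq_bracketing[OF _ J]) simp
  with J show ?thesis by simp
qed

lemma J_set_eqI:
  assumes "A \<subseteq> {1..n}" "bracketing ({1..n} - symdiff A D) (A \<inter> D) J"
  shows "J_set n A D = J" "J_candidates n A D \<noteq> {}"
proof -
  show "J_set n A D = J"
    unfolding J_set_def J_candidates_eq[OF assms(1)]
    by (rule comp_smallest_eq_bracketing[OF _ assms(2)]) simp
  show "J_candidates n A D \<noteq> {}"
    using assms(2) unfolding J_candidates_eq[OF assms(1)] bracketing_def
    by (auto simp: subset_Diff_iff intro!: exI[of _ J])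
qed

lemma I1_set_eqI:
  assumes "B \<subseteq> {1..n}" "bracketing ({1..n+k} - symdiff B C) X (J1_set n B k C)"
  shows "I1_set n B k C = X" "I1_candidates n B k C \<noteq> {}"
proof -
  show "I1_set n B k C = X"
    unfolding I1_set_def I1_candidates_eq[OF assms(1)]
    by (rule comp_largest_eq_bracketing[OF _ assms(2)]) simp
  show "I1_candidates n B k C \<noteq> {}"
    using assms(2) unfolding I1_candidates_eq[OF assms(1)] bracketing_def
    by (auto simp: subset_Diff_iff intro!: exI[of _ X])
qed

section \<open>\<open>Psi\<close> on the underlying sets and its inverse\<close>

text \<open>Passing from \<open>A\<close>, \<open>D\<close> to \<open>B\<close>, \<open>C\<close>
  replaces \<open>I\<close> by \<open>J\<close> in both sets and keeps the symmetric difference. The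
  ambient sets thus agree up to the new positions, and extending the bracketing by \<open>K\<close>
  gives Lecouvey's.\<close>

lemma semistandard_data_image:
  assumes "semistandard_data n A k D"
  defines "J \<equiv> J_set n A D" and "K \<equiv> K_set n A k D"
    and "B \<equiv> B_set n A D" and "C \<equiv> C_set n A D"
  shows "admissible_data n B k C" "B \<inter> C = J" "symdiff B C = symdiff A D"
    "B - C = A - D" "C - B = D - A" "I1_set n B k C = (A \<inter> D) \<union> K"
    "(B - J1_set n B k C) \<union> I1_set n B k C = A \<union> K"
    "(C - J1_set n B k C) \<union> I1_set n B k C = D \<union> K"
    "card B = card A" "card C = card D"
proof -
  define F where "F = {1..n} - symdiff A D"
  define I where "I = A \<inter> D"
  have AD: "A \<subseteq> {1..n}" "D \<subseteq> {1..n}" and card: "card (A \<union> D \<union> J) + k \<le> n"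
    using assms by (auto simp: semistandard_data_def)
  have br: "bracketing F I J"
    using semistandard_data_bracketing assms(1) by (simp add: F_def I_def J_def)
  then have J: "J \<subseteq> F" "I \<inter> J = {}" "card J = card I" by (auto simp: bracketing_def ballot_def)
  then have JAD: "J \<inter> A = {}" "J \<inter> D = {}" "J \<subseteq> {1..n}"
    by (auto simp: F_def I_def symdiff_def)
  have fin: "finite A" "finite D" "finite J"
    using AD JAD(3) by (auto intro: finite_subset)
  have B: "B = (A - D) \<union> J" and C: "C = (D - A) \<union> J"
    by (auto simp: B_def C_def B_set_def C_set_def J_def)
  show BC: "B \<inter> C = J" "symdiff B C = symdiff A D" "B - C = A - D" "C - B = D - A"
    using JAD by (auto simp: B C symdiff_def)
  have J1: "J1_set n B k C = J \<union> {n+1..n+k}" by (simp add: J1_set_def BC)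
  have free: "{1..n} - (A \<union> D \<union> J) = F - (I \<union> J)"
    by (auto simp: F_def I_def symdiff_def)
  \<comment> \<open>The cardinality condition of semistandardness ensures that \<open>K\<close>
    really has \<open>k\<close> elements.\<close>
  have "k \<le> card ({1..n} - (A \<union> D \<union> J))"
    using card AD JAD fin by (subst card_Diff_subset) auto
  then have K: "K \<subseteq> F - (I \<union> J)" "card K = k"
    "\<And>x y. x \<in> K \<Longrightarrow> y \<in> F - (I \<union> J) - K \<Longrightarrow> y < x"
    using largest_elements_properties[of "{1..n} - (A \<union> D \<union> J)" k]
    unfolding K_def K_set_def J_def[symmetric] free[symmetric] by simp_all
  have above: "A \<inter> {n+1..n+k} = {}" "D \<inter> {n+1..n+k} = {}" using AD by fastforce+
  have interval: "{1..n+k} = {1..n} \<union> {n+1..n+k}" by auto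
  have "F \<union> {n+1..n+k} = {1..n+k} - symdiff B C"
    using above unfolding BC(2) interval F_def unfolding symdiff_def by blast
  then have br1: "bracketing ({1..n+k} - symdiff B C) (I \<union> K) (J1_set n B k C)"
    using bracketing_extend[OF _ br K, of n] J1 by (simp add: F_def)
  have BCn: "B \<subseteq> {1..n}" "C \<subseteq> {1..n}" using AD JAD by (auto simp: B C)
  show I1: "I1_set n B k C = (A \<inter> D) \<union> K"
    using I1_set_eqI(1)[OF BCn(1) br1] by (simp add: I_def)
  show "admissible_data n B k C"
    using I1_set_eqI(2)[OF BCn(1) br1] BCn by (simp add: admissible_data_def)
  have "B - J1_set n B k C = A - D" "C - J1_set n B k C = D - A"
    using JAD(1,2) above unfolding J1 unfolding B C by blast+
  then show "(B - J1_set n B k C) \<union> I1_set n B k C = A \<union> K"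
    "(C - J1_set n B k C) \<union> I1_set n B k C = D \<union> K"
    unfolding I1 by auto
  have "card B = card (A - D) + card J" "card C = card (D - A) + card J"
    unfolding B C using fin JAD by (auto intro!: card_Un_disjoint)
  moreover have "card A = card (A - D) + card I" "card D = card (D - A) + card I"
    using card_Int_Diff[OF fin(1), of D] card_Int_Diff[OF fin(2), of A]
    by (simp_all add: I_def Int_commute)
  ultimately show "card B = card A" "card C = card D" using J(3) by auto
qed

text \<open>Dropping the \<open>k\<close> largest elements of a candidate \<open>X\<close> undoes
  the extension: what remains lies below \<open>J\<close> componentwise, so a bracketing with right
  side \<open>J\<close> exists, and its left side serves as \<open>A \<inter> D\<close>.\<close>

lemma admissible_data_preimage:
  assumes "admissible_data n B k C"
  shows "\<exists>A D. semistandard_data n A k D \<and> B_set n A D = B \<and> C_set n A D = C"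
proof -
  define F where "F = {1..n} - symdiff B C"
  define J where "J = B \<inter> C"
  have BC: "B \<subseteq> {1..n}" "C \<subseteq> {1..n}" using assms by (auto simp: admissible_data_def)
  obtain X where X: "X \<subseteq> ({1..n+k} - symdiff B C) - J1_set n B k C" "ballot X (J1_set n B k C)"
    using assms unfolding admissible_data_def I1_candidates_eq[OF BC(1)] by blast
  have J1: "J1_set n B k C = J \<union> {n+1..n+k}" by (simp add: J1_set_def J_def)
  \<comment> \<open>The positions beyond \<open>n\<close> all belong to
    \<open>J1_set n B k C\<close>, which \<open>X\<close> avoids.\<close>
  have XF: "X \<subseteq> F - J" using X(1) by (fastforce simp: J1 F_def)
  have J: "J \<subseteq> F" using BC by (auto simp: F_def J_def symdiff_def)
  have Jn: "J \<subseteq> {1..n}" using BC by (auto simp: J_def)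
  have fin: "finite F" "finite J" "finite X"
    using J XF by (auto simp: F_def intro: finite_subset)
  have disj: "J \<inter> {n+1..n+k} = {}" using Jn by fastforce
  have cardX: "card X = card J + k"
    using X(2) disj fin by (simp add: ballot_def J1 card_Un_disjoint)
  define X0 where "X0 = X - largest_elements k X"
  have top: "largest_elements k X \<subseteq> X" "card (largest_elements k X) = k"
    "\<And>x y. x \<in> largest_elements k X \<Longrightarrow> y \<in> X0 \<Longrightarrow> y < x"
    using largest_elements_properties[of X k] fin cardX by (auto simp: X0_def)
  have fin0: "finite (largest_elements k X)" "finite X0"
    using top(1) fin by (auto simp: X0_def intro: finite_subset)
  have card0: "card X0 = card J"
    using top fin fin0 cardX by (simp add: X0_def card_Diff_subset)
  have "count_below J t \<le> count_below X0 t" for t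
  \<comment> \<open>Once a dropped element is below \<open>t\<close>, all of \<open>X0\<close> is,
    and its count is full. Before that \<open>X0\<close> counts exactly like
    \<open>X\<close>.\<close>
  proof (cases "\<exists>x\<in>largest_elements k X. x < t")
    case True
    then have "count_below X0 t = card X0"
      using top(3) by (intro count_below_eq_card) (meson less_trans)
    then show ?thesis using card0 count_below_le_card[OF fin(2)] by simp
  next
    case False
    then have "count_below (largest_elements k X) t = 0"
      by (intro count_below_eq_0) (auto simp: not_less)
    moreover have "count_below (largest_elements k X \<union> X0) t
      = count_below (largest_elements k X) t + count_below X0 t"
      using fin0 by (intro count_below_Un) (auto simp: X0_def)
    moreover have "largest_elements k X \<union> X0 = X" using top(1) by (auto simp: X0_def)
    moreover have "count_below J t \<le> count_below (J \<union> {n+1..n+k}) t"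
      using fin by (intro count_below_subset) auto
    ultimately show ?thesis using X(2) unfolding J1 ballot_def by (metis add_0 le_trans)
  qed
  then have "ballot X0 J" using card0 by (simp add: ballot_def)
  moreover have "X0 \<subseteq> F - J" using XF by (auto simp: X0_def)
  ultimately obtain I where I: "bracketing F I J"
    using bracketing_exists_left[OF fin(1) J] by blast
  then have IF: "I \<subseteq> F" "I \<inter> J = {}" "card I = card J" by (auto simp: bracketing_def ballot_def)
  define A where "A = (B - C) \<union> I"
  define D where "D = (C - B) \<union> I"
  have IBC: "I \<inter> B = {}" "I \<inter> C = {}" "I \<subseteq> {1..n}"
    using IF(1,2) by (auto simp: F_def J_def symdiff_def)
  have AD: "A \<subseteq> {1..n}" "D \<subseteq> {1..n}" using IBC BC by (auto simp: A_def D_def)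
  have AI: "A \<inter> D = I" "symdiff A D = symdiff B C"
    using IBC by (auto simp: A_def D_def symdiff_def)
  have br: "bracketing ({1..n} - symdiff A D) (A \<inter> D) J" using I by (simp add: AI F_def)
  have JS: "J_set n A D = J" "J_candidates n A D \<noteq> {}"
    using J_set_eqI[OF AD(1) br] by auto
  \<comment> \<open>This becomes the cardinality condition: \<open>card X\<close> is
    \<open>card J + k\<close>, so two copies of \<open>card J\<close>, one standing for
    \<open>card I\<close>, and \<open>k\<close> fit into \<open>F\<close>.\<close>
  have "card J + card X \<le> card F"
  proof -
    have "J \<inter> X = {}" "J \<union> X \<subseteq> F" using XF J by auto
    then show ?thesis
      using card_Un_disjoint[of J X] card_mono[of F "J \<union> X"] fin by simp
  qed
  moreover have "card (symdiff A D) + card F = n"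
  proof -
    have "symdiff A D \<subseteq> {1..n}" using AD by (auto simp: symdiff_def)
    then have "card F = n - card (symdiff A D)" "card (symdiff A D) \<le> n"
      using card_Diff_subset[of "symdiff A D" "{1..n}"] card_mono[of "{1..n}" "symdiff A D"]
      by (auto simp: F_def AI finite_subset)
    then show ?thesis by simp
  qed
  moreover have "A \<union> D \<union> J = symdiff A D \<union> (I \<union> J)" using AI(1) by (auto simp: symdiff_def)
  then have "card (A \<union> D \<union> J) \<le> card (symdiff A D) + (card I + card J)"
    using card_Un_le[of "symdiff A D" "I \<union> J"] card_Un_le[of I J] by simp
  ultimately have "semistandard_data n A k D"
    using AD JS IF(3) cardX by (simp add: semistandard_data_def)
  moreover have "B_set n A D = B" "C_set n A D = C"
    unfolding B_set_def C_set_def JS using IBC by (auto simp: A_def D_def J_def)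
  ultimately show ?thesis by blast
qed

text \<open>\<open>B\<close> and \<open>C\<close> determine \<open>J\<close>, both differences of
  \<open>A\<close> and \<open>D\<close> and the ambient set; the missing \<open>A \<inter> D\<close>
  is the unique left side of the bracketing.\<close>

lemma semistandard_data_inj:
  assumes "semistandard_data n A k D" "semistandard_data n A' k D'"
    "B_set n A D = B_set n A' D'" "C_set n A D = C_set n A' D'"
  shows "A = A' \<and> D = D'"
proof -
  note im = semistandard_data_image[OF assms(1)] and im' = semistandard_data_image[OF assms(2)]
  have "J_set n A D = J_set n A' D'" "symdiff A D = symdiff A' D'" and dif: "A - D = A' - D'" "D - A = D' - A'"
    using im(2-5) im'(2-5) assms(3,4) by auto
  then have "A \<inter> D = A' \<inter> D'"
    using semistandard_data_bracketing[OF assms(1)] semistandard_data_bracketing[OF assms(2)]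
    by (intro bracketing_left_unique[of "{1..n} - symdiff A D" _ "J_set n A D"]) simp_all
  with dif show ?thesis by blast
qed

section \<open>From sets to columns as lists\<close>

lemma length_col: "finite A \<Longrightarrow> finite D \<Longrightarrow> length (col A k D) = card A + k + card D"
  by (simp add: col_def card_image inj_on_def)

lemma semistandard_data_finite:
  assumes "semistandard_data n A k D"
  shows "finite A" "finite D" "finite (B_set n A D)" "finite (C_set n A D)"
  using assms semistandard_data_image(1)[OF assms]
  unfolding semistandard_data_def admissible_data_def
  by (meson finite_atLeastAtMost finite_subset)+

lemma Psi_col:
  "semistandard_data n A k D \<Longrightarrow> Psi n (col A k D) = col (B_set n A D) k (C_set n A D)"
  by (simp add: Psi_def col_read semistandard_data_finite)

lemma length_Psi:
  assumes "c \<in> semistandard_columns n"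
  shows "length (Psi n c) = length c"
proof -
  obtain A k D where "c = col A k D" "semistandard_data n A k D"
    using assms by (auto simp: semistandard_columns_def)
  then show ?thesis
    using semistandard_data_finite semistandard_data_image(9,10) by (simp add: Psi_col length_col)
qed

lemma lecouvey_split_Psi:
  assumes "c \<in> semistandard_columns n"
  shows "lecouvey_split n (Psi n c) = dble n c"
proof -
  obtain A k D where c: "c = col A k D" "semistandard_data n A k D"
    using assms by (auto simp: semistandard_columns_def)
  note fin = semistandard_data_finite[OF c(2)]
  show ?thesis
    using semistandard_data_image(7,8)[OF c(2)]
    by (simp add: c(1) Psi_col[OF c(2)] lecouvey_split_def dble_def Let_def col_read fin)
qed

lemma bij_betw_Psi: "bij_betw (Psi n) (semistandard_columns n) (admissible_columns n)"
  unfolding bij_betw_def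
proof
  show "inj_on (Psi n) (semistandard_columns n)"
  proof (rule inj_onI)
    fix c c' assume "c \<in> semistandard_columns n" "c' \<in> semistandard_columns n" and eq: "Psi n c = Psi n c'"
    then obtain A k D A' k' D' where c: "c = col A k D" "semistandard_data n A k D"
      and c': "c' = col A' k' D'" "semistandard_data n A' k' D'"
      by (auto simp: semistandard_columns_def)
    have "col (B_set n A D) k (C_set n A D) = col (B_set n A' D') k' (C_set n A' D')"
      using eq c c' by (simp add: Psi_col)
    \<comment> \<open>A column determines its two sets and its number of zeros, so equality of lists
      passes to the data.\<close>
    then have "B_set n A D = B_set n A' D'" "k = k'" "C_set n A D = C_set n A' D'"
      using col_read semistandard_data_finite(3,4) c(2) c'(2) by metis+
    then show "c = c'" using semistandard_data_inj c c' by metis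
  qed
  show "Psi n ` semistandard_columns n = admissible_columns n"
  proof (intro equalityI subsetI)
    fix c assume "c \<in> Psi n ` semistandard_columns n"
    then show "c \<in> admissible_columns n"
      using semistandard_data_image(1)
      by (auto simp: semistandard_columns_def admissible_columns_def Psi_col) blast
  next
    fix c assume "c \<in> admissible_columns n"
    then obtain B k C where "c = col B k C" "admissible_data n B k C"
      by (auto simp: admissible_columns_def)
    then obtain A D where "semistandard_data n A k D" "c = Psi n (col A k D)"
      using admissible_data_preimage Psi_col by metis
    then show "c \<in> Psi n ` semistandard_columns n"
      by (auto simp: semistandard_columns_def)
  qed
qed

section \<open>Tableaux\<close>

text \<open>No letter lies strictly between \<open>Unbarred m\<close> and
  \<open>Unbarred (Suc m)\<close>, so each strict increase climbs at least one step. Rows are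
  counted from \<open>0\<close>, whence \<open>Suc i\<close>.\<close>

lemma strictly_sorted_nth_ge:
  assumes "sorted_wrt (<) c" "\<And>x. x \<in> set c \<Longrightarrow> Unbarred 1 \<le> x" "i < length c"
  shows "Unbarred (Suc i) \<le> c ! i"
  using assms(3)
proof (induction i)
  case 0
  then show ?case using assms(2)[of "c ! 0"] by simp
next
  case (Suc i)
  then have "Unbarred (Suc i) < c ! Suc i"
    using assms(1) by (metis Suc_lessD lessI order_le_less_trans sorted_wrt_nth_less)
  then show ?case by (cases "c ! Suc i") (auto simp: less_letter_def)
qed

lemma sorted_list_of_set_initial:
  "sorted_list_of_set (Unbarred ` {1..n}) = map Unbarred [1..<Suc n]"
proof -
  have "sorted (map Unbarred [1..<Suc n])"
    by (simp add: sorted_map del: upt_Suc)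
  moreover have "distinct (map Unbarred [1..<Suc n])"
    by (simp add: distinct_map inj_on_def)
  moreover have "set (map Unbarred [1..<Suc n]) = Unbarred ` {1..n}"
    by (simp add: atLeastLessThanSuc_atLeastAtMost del: upt_Suc)
  ultimately show ?thesis
    by (metis sorted_list_of_set.idem_if_sorted_distinct)
qed

lemma spin_column_properties:
  assumes "c \<in> spin_columns n"
  shows "length c = n" "i < n \<Longrightarrow> col {1..n} 0 {} ! i \<le> c ! i"
proof -
  obtain A D where c: "c = col A 0 D" and AD: "A \<union> D = {1..n}" "A \<inter> D = {}"
    using assms by (auto simp: spin_columns_def)
  have fin: "finite A" "finite D" using AD(1) by (metis finite_Un finite_atLeastAtMost)+
  show len: "length c = n"
    using card_Un_disjoint[OF fin AD(2)] AD(1) by (simp add: c length_col fin)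
  have "sorted_wrt (<) c"
    using fin by (auto simp: c col_def sorted_wrt_append less_letter_def)
  moreover have "Unbarred 1 \<le> x" if "x \<in> set c" for x
    using that fin AD(1) by (auto simp: c col_def)
  moreover assume "i < n"
  ultimately have "Unbarred (Suc i) \<le> c ! i" using len by (intro strictly_sorted_nth_ge) auto
  moreover have "col {1..n} 0 {} ! i = Unbarred (Suc i)"
    using \<open>i < n\<close> unfolding col_def sorted_list_of_set_initial by (simp del: upt_Suc)
  ultimately show "col {1..n} 0 {} ! i \<le> c ! i" by simp
qed

text \<open>Both columns have height \<open>n\<close>, so each row reaching \<open>c\<close> gets
  one more entry in front, already at most its neighbour. This absorbs the difference between
  doubling a spin column and keeping it single.\<close>

lemma rows_weakly_increasing_spin:
  assumes "c \<in> spin_columns n"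
  shows "rows_weakly_increasing (col {1..n} 0 {} # c # R) \<longleftrightarrow> rows_weakly_increasing (c # R)"
proof -
  have "length (col {1..n} 0 {}) = n" by (simp add: length_col)
  then have "sorted (row i (col {1..n} 0 {} # c # R)) \<longleftrightarrow> sorted (row i (c # R))" for i
    using spin_column_properties(1)[OF assms] spin_column_properties(2)[OF assms, of i] by (fastforce simp: row_def)
  then show ?thesis by (simp add: rows_weakly_increasing_def)
qed

section \<open>Transfer of shape and row conditions to tableaux\<close>

lemma tableau_over_Psi:
  assumes "orthogonal_tableau n T"
  shows "tableau_over n (admissible_columns n) (Psi_tableau n T)"
proof -
  have T: "set T \<subseteq> Nonspin ` semistandard_columns n \<union> Spin ` spin_columns n"
    "sorted_wrt (\<ge>) (map (\<lambda>c. length (entries c)) T)"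
    "\<And>i. i < length T \<Longrightarrow> is_spin (T ! i) \<Longrightarrow> i = 0"
    using assms by (auto simp: orthogonal_tableau_def tableau_over_def)
  have img: "Psi n c \<in> admissible_columns n" if "c \<in> semistandard_columns n" for c
    using that bij_betw_Psi bij_betwE by blast
  have spin: "is_spin (Psi_column n x) = is_spin x" for x by (cases x) auto
  have "length (entries (Psi_column n x)) = length (entries x)" if "x \<in> set T" for x
    using that T(1) length_Psi by (cases x) auto
  then have "map (\<lambda>c. length (entries c)) (Psi_tableau n T) = map (\<lambda>c. length (entries c)) T"
    by (simp add: Psi_tableau_def)
  then have "sorted_wrt (\<ge>) (map (\<lambda>c. length (entries c)) (Psi_tableau n T))"
    using T(2) by (simp only:)
  moreover have "set (Psi_tableau n T) \<subseteq> Nonspin ` admissible_columns n \<union> Spin ` spin_columns n"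
  proof
    fix y assume "y \<in> set (Psi_tableau n T)"
    then obtain x where "x \<in> set T" "y = Psi_column n x" by (auto simp: Psi_tableau_def)
    then show "y \<in> Nonspin ` admissible_columns n \<union> Spin ` spin_columns n"
      using T(1) img by (cases x) auto
  qed
  ultimately show ?thesis
    using T(3) unfolding tableau_over_def by (auto simp: Psi_tableau_def spin)
qed

text \<open>For non-spin columns split and double are literally the same pair, and a spin column can
  only come first, so the two juxtapositions differ at most by the leading column
  \<open>1, ..., n\<close>.\<close>

lemma rows_weakly_increasing_Psi:
  assumes "orthogonal_tableau n T"
  shows "rows_weakly_increasing (concat (map (dble_column n) T)) \<longleftrightarrow>
    rows_weakly_increasing (concat (map (split_column n) (Psi_tableau n T)))"
proof -
  have T: "set T \<subseteq> Nonspin ` semistandard_columns n \<union> Spin ` spin_columns n"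
    "\<And>i. i < length T \<Longrightarrow> is_spin (T ! i) \<Longrightarrow> i = 0"
    using assms by (auto simp: orthogonal_tableau_def tableau_over_def)
  have nonspin: "split_column n (Psi_column n x) = dble_column n x" if "x \<in> set T" "\<not> is_spin x" for x
    using that T(1) lecouvey_split_Psi by (cases x) auto
  show ?thesis
  proof (cases T)
    case Nil
    then show ?thesis by (simp add: Psi_tableau_def)
  next
    case (Cons x T')
    have "\<not> is_spin y" if y: "y \<in> set T'" for y
    proof
      assume "is_spin y"
      moreover obtain i where "i < length T'" "y = T' ! i" using y by (metis in_set_conv_nth)
      \<comment> \<open>Position \<open>i\<close> of the tail is position \<open>Suc i\<close> of
        \<open>T\<close>, which is not the first.\<close>
      ultimately show False using T(2)[of "Suc i"] Cons by simp
    qed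
    then have "map (split_column n) (Psi_tableau n T') = map (dble_column n) T'"
      using nonspin Cons by (simp add: Psi_tableau_def)
    then have split: "concat (map (split_column n) (Psi_tableau n T)) =
      split_column n (Psi_column n x) @ concat (map (dble_column n) T')"
      unfolding Cons by (simp add: Psi_tableau_def flip: map_map)
    show ?thesis
    proof (cases x)
      case (Nonspin c)
      then have "split_column n (Psi_column n x) = dble_column n x"
        using nonspin[of x] Cons by simp
      then show ?thesis unfolding split by (simp add: Cons)
    next
      case (Spin c)
      then have "c \<in> spin_columns n" using T(1) Cons by auto
      then show ?thesis
        unfolding split using Cons Spin rows_weakly_increasing_spin by simp
    qed
  qed
qed

theorem mainTheorem3:
  fixes n :: nat
  assumes "n \<ge> 1"
  shows "bij_betw (Psi n) (semistandard_columns n) (admissible_columns n) \<and>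
    (\<forall>c\<in>semistandard_columns n. lecouvey_split n (Psi n c) = dble n c) \<and>
    (\<forall>T. orthogonal_tableau n T \<longrightarrow>
       (semistandard_tableau n T \<longleftrightarrow> lecouvey_semistandard_tableau n (Psi_tableau n T)))"
  using bij_betw_Psi lecouvey_split_Psi rows_weakly_increasing_Psi tableau_over_Psi
  by (simp add: semistandard_tableau_def lecouvey_semistandard_tableau_def)

end
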